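(* Let $p,q,\upsilon,\gamma_1,\dots,\gamma_6,\sigma,\tau,w_1,w_2\in\mathbb{C}$ with $\operatorname{Re}(p)>0$, $\operatorname{Re}(q)>0$, $\operatorname{Re}(\upsilon)>0$, $\gamma_4,\gamma_5,\gamma_6\notin\{0,-1,-2,\dots\}$, $\operatorname{Re}(\sigma)>0$ and $\operatorname{Re}(\tau)>0$. Let $a,b\in\mathbb{R}$, $z>a$, $t>b$. Then $$\left({}_{z}\mathbb{I}_{a^{+}}^{\sigma}\,{}_{t}\mathbb{I}_{b^{+}}^{\tau}\right)\left[(z-a)^{p-1}(t-b)^{q-1}E_{\gamma_{4},\gamma_{5},\gamma_{6};p;q;\upsilon}^{(\gamma_{1};\gamma_{2};\gamma_{3})}(w_{1}(z-a),w_{2}(t-b))\right]$$ $$=(z-a)^{p+\sigma-1}(t-b)^{q+\tau-1}E_{\gamma_{4},\gamma_{5},\gamma_{6};p+\sigma;q+\tau;\upsilon}^{(\gamma_{1};\gamma_{2};\gamma_{3})}(w_{1}(z-a),w_{2}(t-b)).$$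
   Context: $(a)_n$ is the Pochhammer symbol. The modified bivariate I-Konhauser Mittag-Leffler function is $$E_{\gamma_{4},\gamma_{5},\gamma_{6};p;q;\upsilon}^{(\gamma_{1};\gamma_{2};\gamma_{3})}(z,t)=\sum_{l=0}^{\infty}\sum_{n=0}^{\infty}\frac{(-1)^{l}(\gamma_{1})_{2l}(\gamma_{2})_{l+n}(\gamma_{3})_{l}\,z^{l}t^{\upsilon n}}{(\gamma_{4})_{l}(\gamma_{5})_{l}(\gamma_{6})_{l}\,\Gamma(p+l)\,\Gamma(q+\upsilon n)\,n!\,l!}.$$ For $s>0$, $(w_2s)^{\upsilon n}$ means $(w_2^{\upsilon})^n s^{\upsilon n}$ with a fixed choice of $w_2^\upsilon$ (and $w_2^{\upsilon}=0$ if $w_2=0$). The double Riemann-Liouville fractional integral is $$\left({}_{z}\mathbb{I}_{a^{+}}^{\sigma}\,{}_{t}\mathbb{I}_{b^{+}}^{\tau}\right)d(z,t)=\frac{1}{\Gamma(\tau)\Gamma(\sigma)}\int_b^t\int_a^z(z-\xi)^{\sigma-1}(t-y)^{\tau-1}d(\xi,y)\,d\xi\,dy,\qquad z>a,\ t>b.$$ *)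

theory Defs
  imports "HOL-Analysis.Analysis"
begin

text \<open>
  \<open>powr_value w \<upsilon> c\<close> says that \<open>c\<close> is one of the (in general many) values of the
  complex power \<open>w\<close> to the \<open>\<upsilon>\<close>, i.e. \<open>exp (\<upsilon> * L)\<close> for some logarithm \<open>L\<close> of \<open>w\<close>;
  the power of zero is zero by convention.
\<close>

definition powr_value :: "complex \<Rightarrow> complex \<Rightarrow> complex \<Rightarrow> bool" where
  "powr_value w \<upsilon> c \<longleftrightarrow>
     (if w = 0 then c = 0 else \<exists>L. exp L = w \<and> c = exp (\<upsilon> * L))"

text \<open>
  The second argument of the function is of the form \<open>w * s\<close> with \<open>s > 0\<close> real and \<open>w\<close>
  complex, and enters only through \<open>(w * s)\<close> to the \<open>\<upsilon> * n\<close>, which is read as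
  \<open>c ^ n * s powr (\<upsilon> * n)\<close> for a fixed value \<open>c\<close> of \<open>w\<close> to the \<open>\<upsilon>\<close>. The argument is
  therefore passed as the pair \<open>c\<close>, \<open>s\<close>; the choice \<open>c = 1\<close> gives the function at \<open>s\<close> itself.
\<close>

definition konhauser_ML ::
  "complex \<Rightarrow> complex \<Rightarrow> complex \<Rightarrow> complex \<Rightarrow> complex \<Rightarrow> complex \<Rightarrow>
   complex \<Rightarrow> complex \<Rightarrow> complex \<Rightarrow> complex \<Rightarrow> complex \<Rightarrow> real \<Rightarrow> complex" where
  "konhauser_ML \<gamma>1 \<gamma>2 \<gamma>3 \<gamma>4 \<gamma>5 \<gamma>6 p q \<upsilon> x c s =
     (\<Sum>l. \<Sum>n.
        (- 1) ^ l * pochhammer \<gamma>1 (2 * l) * pochhammer \<gamma>2 (l + n) * pochhammer \<gamma>3 l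
          * x ^ l * (c ^ n * complex_of_real s powr (\<upsilon> * of_nat n))
        / (pochhammer \<gamma>4 l * pochhammer \<gamma>5 l * pochhammer \<gamma>6 l
            * Gamma (p + of_nat l) * Gamma (q + \<upsilon> * of_nat n) * fact n * fact l))"

definition RL_integrand ::
  "complex \<Rightarrow> complex \<Rightarrow> (real \<Rightarrow> real \<Rightarrow> complex) \<Rightarrow> real \<Rightarrow> real \<Rightarrow> real \<Rightarrow> real \<Rightarrow> complex" where
  "RL_integrand \<sigma> \<tau> d z t \<xi> y =
     complex_of_real (z - \<xi>) powr (\<sigma> - 1) * complex_of_real (t - y) powr (\<tau> - 1) * d \<xi> y"

text \<open>
  The Bochner integral is total, with value zero for a non-integrable function, so
  existence of the double integral is a separate predicate.
\<close>

definition RL_integrable ::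
  "real \<Rightarrow> real \<Rightarrow> complex \<Rightarrow> complex \<Rightarrow> (real \<Rightarrow> real \<Rightarrow> complex) \<Rightarrow> real \<Rightarrow> real \<Rightarrow> bool" where
  "RL_integrable a b \<sigma> \<tau> d z t \<longleftrightarrow>
     set_integrable lborel ({a<..<z} \<times> {b<..<t}) (\<lambda>(\<xi>, y). RL_integrand \<sigma> \<tau> d z t \<xi> y)"

definition RL_integral ::
  "real \<Rightarrow> real \<Rightarrow> complex \<Rightarrow> complex \<Rightarrow> (real \<Rightarrow> real \<Rightarrow> complex) \<Rightarrow> real \<Rightarrow> real \<Rightarrow> complex" where
  "RL_integral a b \<sigma> \<tau> d z t =
     1 / (Gamma \<tau> * Gamma \<sigma>)
       * (LINT y:{b<..<t}|lborel. (LINT \<xi>:{a<..<z}|lborel. RL_integrand \<sigma> \<tau> d z t \<xi> y))"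

end

theory Submission imports Defs begin

text \<open>
  A Riemann-Liouville integral sends the power \<open>(x - a) powr (s - 1)\<close> to
  \<open>(x - a) powr (s + \<sigma> - 1)\<close> times \<open>Gamma s / Gamma (s + \<sigma>)\<close>; this is Euler's Beta integral.
  Multiplied by its prefactor, the I-Konhauser Mittag-Leffler function becomes a double series in
  the products of powers with \<open>s = p + l\<close> in the first variable and \<open>s = q + \<upsilon> * n\<close> in
  the second, and its coefficients contain exactly the factors \<open>1 / Gamma (p + l)\<close> and
  \<open>1 / Gamma (q + \<upsilon> * n)\<close>. Termwise integration therefore replaces \<open>p\<close> by \<open>p + \<sigma>\<close> and \<open>q\<close>
  by \<open>q + \<tau>\<close> and changes nothing else.

  The work lies in the Beta integral for complex exponents and in the interchange of sums and
  integrals. The first (\<open>has_bochner_integral_beta_kernel\<close>) follows from the Gamma integral by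
  Fubini's theorem. For the second it is enough that the coefficients are dominated by a product
  of a summable sequence in \<open>l\<close> and one in \<open>n\<close>
  (\<open>integral_dominated_double_series\<close>). The Pochhammer symbols and factorials together grow at
  most geometrically (\<open>konhauser_coeff_bound\<close>), so the remaining question is whether
  \<open>K ^ n / Gamma (q + u * n)\<close> is absolutely summable for all \<open>K\<close> (\<open>summable_power_over_Gamma\<close>).
  The Beta integral answers this as well: the ratio of consecutive terms is a constant multiple
  of the Beta integral with exponents \<open>u\<close> and \<open>q + u * n\<close>, which tends to 0. The lemma is used
  with \<open>u = \<upsilon>\<close> for the sum over \<open>n\<close> and with \<open>u = 1\<close> for the sum over \<open>l\<close>.
\<close>

section \<open>The complex Beta integral\<close>

lemma measurable_of_real_powr_aux:
  "(\<lambda>x::real. complex_of_real x powr s) \<in> borel_measurable borel"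
proof -
  have eq: "complex_of_real x powr s = (if x > 0 then exp (s * of_real (ln x))
     else if x < 0 then exp (s * (of_real (ln (- x)) + \<i> * of_real pi)) else 0)" for x
  proof -
    have "Ln (complex_of_real x) = of_real (ln (- x)) + \<i> * of_real pi" if "x < 0"
    proof -
      have "Ln (- complex_of_real (- x)) = Ln (of_real (-x)) + \<i> * of_real pi"
        using that by (subst Ln_minus) (auto simp: complex_nonpos_Reals_iff)
      moreover have "Ln (complex_of_real (- x)) = of_real (ln (- x))"
        using that by (intro Ln_of_real) auto
      ultimately show ?thesis by simp
    qed
    thus ?thesis by (auto simp: powr_def Ln_of_real)
  qed
  show ?thesis unfolding eq by measurable
qed

lemma measurable_of_real_powr [measurable (raw)]:
  "f \<in> borel_measurable M \<Longrightarrow> (\<lambda>x. complex_of_real (f x) powr s) \<in> borel_measurable M"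
  using measurable_compose[OF _ measurable_of_real_powr_aux] .

text \<open>
  The integrand of Euler's Beta integral moved to the interval from \<open>lo\<close> to \<open>hi\<close>. The
  indicator is built in, so that one and the same function serves as an integrand over the
  line, as a factor of a product on the plane, and as a term of a series.
\<close>
definition beta_kernel :: "real \<Rightarrow> real \<Rightarrow> complex \<Rightarrow> complex \<Rightarrow> real \<Rightarrow> complex" where
  "beta_kernel lo hi \<alpha> \<beta> x =
     indicator {lo<..<hi} x *\<^sub>R
       (complex_of_real (hi - x) powr (\<alpha> - 1) * complex_of_real (x - lo) powr (\<beta> - 1))"

lemma measurable_beta_kernel [measurable (raw)]:
  assumes [measurable]: "u \<in> borel_measurable M" "f \<in> borel_measurable M"
  shows "(\<lambda>x. beta_kernel lo (u x) \<alpha> \<beta> (f x)) \<in> borel_measurable M"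
proof -
  have "(\<lambda>x. beta_kernel lo (u x) \<alpha> \<beta> (f x)) = (\<lambda>x. (if lo < f x \<and> f x < u x then 1 else 0) *\<^sub>R
     (complex_of_real (u x - f x) powr (\<alpha> - 1) * complex_of_real (f x - lo) powr (\<beta> - 1)))"
    by (auto simp: beta_kernel_def fun_eq_iff)
  also have "\<dots> \<in> borel_measurable M"
    by measurable
  finally show ?thesis .
qed

lemma norm_of_real_powr: "x > 0 \<Longrightarrow> norm (complex_of_real x powr s) = x powr Re s"
  by (simp add: norm_powr_real_powr)

lemma norm_beta_kernel:
  "norm (beta_kernel lo hi \<alpha> \<beta> x) =
     indicator {lo<..<hi} x * ((hi - x) powr (Re \<alpha> - 1) * (x - lo) powr (Re \<beta> - 1))"
proof (cases "lo < x \<and> x < hi")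
  case True
  hence "norm (complex_of_real (hi - x) powr (\<alpha> - 1)) = (hi - x) powr (Re \<alpha> - 1)"
        "norm (complex_of_real (x - lo) powr (\<beta> - 1)) = (x - lo) powr (Re \<beta> - 1)"
    using norm_of_real_powr[of "hi - x" "\<alpha> - 1"] norm_of_real_powr[of "x - lo" "\<beta> - 1"] by auto
  thus ?thesis using True by (simp only: beta_kernel_def norm_scaleR norm_mult abs_indicator)
qed (auto simp: beta_kernel_def)

lemma of_real_mult_powr:
  assumes "x > 0" "y > 0"
  shows "complex_of_real (x * y) powr s = complex_of_real x powr s * complex_of_real y powr s"
  using assms by (simp add: powr_def Ln_of_real ln_mult exp_add ring_distribs flip: of_real_mult)

text \<open>
  Homogeneity: the two powers contribute \<open>\<alpha> - 1\<close> and \<open>\<beta> - 1\<close> factors of the length of the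
  interval, and the Jacobian of the substitution later supplies one more.
\<close>
lemma beta_kernel_affine:
  assumes "lo < hi"
  shows "beta_kernel lo hi \<alpha> \<beta> (lo + (hi - lo) * s) =
    complex_of_real (hi - lo) powr (\<alpha> + \<beta> - 2) * beta_kernel 0 1 \<alpha> \<beta> s"
proof (cases "0 < s \<and> s < 1")
  case True
  have 1: "hi - (lo + (hi - lo) * s) = (hi - lo) * (1 - s)" "lo + (hi - lo) * s - lo = (hi - lo) * s"
    by (simp_all add: algebra_simps)
  have "(hi - lo) * (1 - s) > 0" "(hi - lo) * s > 0" using True assms by simp_all
  hence "lo < lo + (hi - lo) * s" "lo + (hi - lo) * s < hi" using 1 by linarith+
  hence "beta_kernel lo hi \<alpha> \<beta> (lo + (hi - lo) * s) =
     (complex_of_real (hi - lo) powr (\<alpha> - 1) * complex_of_real (hi - lo) powr (\<beta> - 1)) *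
       (complex_of_real (1 - s) powr (\<alpha> - 1) * complex_of_real s powr (\<beta> - 1))"
    unfolding beta_kernel_def 1 using True assms
    by (subst (1 2) of_real_mult_powr) (simp_all del: of_real_diff)
  also have "complex_of_real (hi - lo) powr (\<alpha> - 1) * complex_of_real (hi - lo) powr (\<beta> - 1) =
      complex_of_real (hi - lo) powr (\<alpha> + \<beta> - 2)"
    by (simp add: powr_add[symmetric] algebra_simps del: of_real_diff)
  finally show ?thesis using True by (simp add: beta_kernel_def)
next
  case False
  have "\<not> (lo < lo + (hi - lo) * s \<and> lo + (hi - lo) * s < hi)"
  proof
    assume "lo < lo + (hi - lo) * s \<and> lo + (hi - lo) * s < hi"
    hence "0 < (hi - lo) * s \<and> 0 < (hi - lo) * (1 - s)" by (auto simp: algebra_simps)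
    thus False using False assms by (auto simp: zero_less_mult_iff)
  qed
  thus ?thesis using False by (auto simp: beta_kernel_def)
qed

lemma integrable_beta_kernel_01:
  assumes "Re \<alpha> > 0" "Re \<beta> > 0"
  shows "integrable lborel (beta_kernel 0 1 \<alpha> \<beta>)"
proof (rule Bochner_Integration.integrable_bound)
  show "integrable lborel (\<lambda>x. indicator {0..1} x *\<^sub>R (x powr (Re \<beta> - 1) * (1 - x) powr (Re \<alpha> - 1)))"
    using integrable_Beta[OF assms(2,1)] by (simp add: set_integrable_def)
  show "AE x in lborel. norm (beta_kernel 0 1 \<alpha> \<beta> x)
      \<le> norm (indicator {0..1} x *\<^sub>R (x powr (Re \<beta> - 1) * (1 - x) powr (Re \<alpha> - 1)))"
    by (intro always_eventually) (auto simp: norm_beta_kernel indicator_def)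
qed measurable

lemma has_bochner_integral_beta_kernel_scaled:
  assumes "lo < hi" "Re \<alpha> > 0" "Re \<beta> > 0"
  shows "has_bochner_integral lborel (beta_kernel lo hi \<alpha> \<beta>)
    (complex_of_real (hi - lo) powr (\<alpha> + \<beta> - 1) * integral\<^sup>L lborel (beta_kernel 0 1 \<alpha> \<beta>))"
proof -
  have "has_bochner_integral lborel (\<lambda>s. beta_kernel lo hi \<alpha> \<beta> (lo + (hi - lo) * s))
    (complex_of_real (hi - lo) powr (\<alpha> + \<beta> - 2) * integral\<^sup>L lborel (beta_kernel 0 1 \<alpha> \<beta>))"
    unfolding beta_kernel_affine[OF assms(1)]
    by (intro has_bochner_integral_mult_right has_bochner_integral_integrable integrable_beta_kernel_01 assms)
  also have "complex_of_real (hi - lo) powr (\<alpha> + \<beta> - 2) =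
      complex_of_real (hi - lo) powr (\<alpha> + \<beta> - 1) / complex_of_real (hi - lo)"
    using powr_diff[of "complex_of_real (hi - lo)" "\<alpha> + \<beta> - 1" 1] assms(1)
    by (simp add: algebra_simps del: of_real_diff)
  finally have "has_bochner_integral lborel (\<lambda>s. beta_kernel lo hi \<alpha> \<beta> (lo + (hi - lo) * s))
     ((complex_of_real (hi - lo) powr (\<alpha> + \<beta> - 1) * integral\<^sup>L lborel (beta_kernel 0 1 \<alpha> \<beta>)) /\<^sub>R \<bar>hi - lo\<bar>)"
    using assms(1) by (simp add: scaleR_conv_of_real field_simps del: of_real_diff)
  thus ?thesis
    using assms(1) lborel_has_bochner_integral_real_affine_iff[of "hi - lo" "beta_kernel lo hi \<alpha> \<beta>" _ lo] by simp
qed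

lemma not_nonpos_Int_if_Re_pos:
  fixes s :: complex
  assumes "Re s > 0"
  shows "s \<notin> \<int>\<^sub>\<le>\<^sub>0"
  using assms by (auto elim!: nonpos_Ints_cases)

lemma Gamma_nonzero_if_Re_pos:
  fixes s :: complex
  shows "Re s > 0 \<Longrightarrow> Gamma s \<noteq> 0"
  using not_nonpos_Int_if_Re_pos by (simp add: Gamma_eq_zero_iff)

definition Gamma_kernel :: "complex \<Rightarrow> real \<Rightarrow> complex" where
  "Gamma_kernel s t = indicator {0<..} t *\<^sub>R (complex_of_real t powr (s - 1) / complex_of_real (exp t))"

lemma measurable_Gamma_kernel [measurable]: "Gamma_kernel s \<in> borel_measurable borel"
  unfolding Gamma_kernel_def by measurable

lemma has_bochner_integral_Gamma_kernel:
  assumes "Re s > 0"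
  shows "has_bochner_integral lborel (Gamma_kernel s) (Gamma s)"
proof -
  let ?f = "\<lambda>t. complex_of_real t powr (s - 1) / complex_of_real (exp t)"
  have abs: "set_integrable lebesgue {0<..} ?f"
    by (rule absolutely_integrable_Gamma_integral'[OF assms])
  hence "integrable lebesgue (Gamma_kernel s)"
    unfolding set_integrable_def Gamma_kernel_def .
  hence int: "integrable lborel (Gamma_kernel s)"
    by (subst (asm) integrable_completion) simp_all
  have "integral\<^sup>L lborel (Gamma_kernel s) = integral\<^sup>L lebesgue (Gamma_kernel s)"
    by (subst integral_completion) simp_all
  also have "\<dots> = integral {0<..} ?f"
    using set_lebesgue_integral_eq_integral(2)[OF abs]
    unfolding set_lebesgue_integral_def Gamma_kernel_def .
  also have "\<dots> = Gamma s"
    using Gamma_integral_complex'[OF assms] by (rule integral_unique)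
  finally show ?thesis using int by (simp add: has_bochner_integral_iff)
qed

text \<open>
  The exponentials combine to a factor free of \<open>t\<close>, so the convolution of the integrands of
  \<open>Gamma \<beta>\<close> and \<open>Gamma \<alpha>\<close> is a Beta integral over the interval from 0 to \<open>v\<close>.
\<close>
lemma Gamma_kernel_convolution:
  "Gamma_kernel \<beta> t * Gamma_kernel \<alpha> (v - t) = of_real (exp (- v)) * beta_kernel 0 v \<alpha> \<beta> t"
proof (cases "0 < t \<and> t < v")
  case True
  have "exp t * exp (v - t) = exp v" by (simp flip: exp_add)
  hence "complex_of_real (exp t) * complex_of_real (exp (v - t)) = complex_of_real (exp v)"
    by (metis of_real_mult)
  thus ?thesis using True
    by (simp add: Gamma_kernel_def beta_kernel_def exp_minus field_simps del: of_real_diff)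
qed (auto simp: Gamma_kernel_def beta_kernel_def)

text \<open>
  The product of the two Gamma integrals is the integral over \<open>v\<close> of the convolution of their
  integrands. By homogeneity the convolution at \<open>v\<close> is the Beta integral times the integrand of
  \<open>Gamma (\<alpha> + \<beta>)\<close>. Absolute convergence, which Fubini's theorem demands, is immediate in
  the order that integrates over \<open>v\<close> first, because Lebesgue measure is translation invariant.
\<close>
lemma integral_beta_kernel_01:
  assumes \<alpha>: "Re \<alpha> > 0" and \<beta>: "Re \<beta> > 0"
  shows "integral\<^sup>L lborel (beta_kernel 0 1 \<alpha> \<beta>) = Gamma \<alpha> * Gamma \<beta> / Gamma (\<alpha> + \<beta>)"
proof -
  define B where "B = integral\<^sup>L lborel (beta_kernel 0 1 \<alpha> \<beta>)"
  let ?H = "\<lambda>t v. Gamma_kernel \<beta> t * Gamma_kernel \<alpha> (v - t)"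
  have shift: "has_bochner_integral lborel (\<lambda>v. Gamma_kernel s (v - t)) (Gamma s)" if "Re s > 0" for s t
    using has_bochner_integral_Gamma_kernel[OF that]
      lborel_has_bochner_integral_real_affine_iff[of 1 "Gamma_kernel s" _ "-t"] by simp
  have int_norm: "(\<integral>v. norm (?H t v) \<partial>lborel) = norm (Gamma_kernel \<beta> t) * (\<integral>v. norm (Gamma_kernel \<alpha> v) \<partial>lborel)" for t
  proof -
    have "(\<integral>v. norm (Gamma_kernel \<alpha> (v - t)) \<partial>lborel) = (\<integral>v. norm (Gamma_kernel \<alpha> v) \<partial>lborel)"
      using lborel_integral_real_affine[of 1 "\<lambda>v. norm (Gamma_kernel \<alpha> v)" "-t"] by simp
    thus ?thesis by (simp add: norm_mult)
  qed
  have int: "integrable (lborel \<Otimes>\<^sub>M lborel) (\<lambda>(t, v). ?H t v)"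
  proof (rule lborel_pair.Fubini_integrable)
    show "(\<lambda>(t, v). ?H t v) \<in> borel_measurable (lborel \<Otimes>\<^sub>M lborel)" by measurable
    show "integrable lborel (\<lambda>t. \<integral>v. norm (case (t, v) of (t, v) \<Rightarrow> ?H t v) \<partial>lborel)"
      unfolding prod.case int_norm
      using has_bochner_integral_Gamma_kernel[OF \<beta>]
      by (intro integrable_mult_left integrable_norm) (auto simp: has_bochner_integral_iff)
    show "AE t in lborel. integrable lborel (\<lambda>v. case (t, v) of (t, v) \<Rightarrow> ?H t v)"
      using shift[OF \<alpha>] by (intro always_eventually) (auto simp: has_bochner_integral_iff)
  qed
  have "(\<integral>v. (\<integral>t. ?H t v \<partial>lborel) \<partial>lborel) = (\<integral>t. (\<integral>v. ?H t v \<partial>lborel) \<partial>lborel)"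
    by (rule lborel_pair.Fubini_integral[OF int])
  also have "\<dots> = Gamma \<beta> * Gamma \<alpha>"
    using shift[OF \<alpha>] has_bochner_integral_Gamma_kernel[OF \<beta>] by (simp add: has_bochner_integral_iff)
  also have "(\<lambda>v. (\<integral>t. ?H t v \<partial>lborel)) = (\<lambda>v. Gamma_kernel (\<alpha> + \<beta>) v * B)"
  proof
    fix v :: real
    show "(\<integral>t. ?H t v \<partial>lborel) = Gamma_kernel (\<alpha> + \<beta>) v * B"
    proof (cases "v > 0")
      case True
      have "(\<integral>t. ?H t v \<partial>lborel) = of_real (exp (- v)) * (complex_of_real v powr (\<alpha> + \<beta> - 1) * B)"
        using has_bochner_integral_beta_kernel_scaled[OF True \<alpha> \<beta>]
        by (simp add: Gamma_kernel_convolution has_bochner_integral_iff B_def)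
      thus ?thesis using True by (simp add: Gamma_kernel_def exp_minus field_simps)
    next
      case False
      hence "?H t v = 0" for t by (auto simp: Gamma_kernel_convolution beta_kernel_def)
      hence "(\<integral>t. ?H t v \<partial>lborel) = 0" by (simp only: integral_zero)
      thus ?thesis using False by (simp add: Gamma_kernel_def)
    qed
  qed
  also have "(\<integral>v. Gamma_kernel (\<alpha> + \<beta>) v * B \<partial>lborel) = Gamma (\<alpha> + \<beta>) * B"
    using has_bochner_integral_Gamma_kernel[of "\<alpha> + \<beta>"] \<alpha> \<beta> by (simp add: has_bochner_integral_iff)
  finally have "Gamma (\<alpha> + \<beta>) * B = Gamma \<beta> * Gamma \<alpha>" .
  moreover have "Gamma (\<alpha> + \<beta>) \<noteq> 0"
    using \<alpha> \<beta> by (intro Gamma_nonzero_if_Re_pos) simp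
  ultimately show ?thesis by (simp add: B_def field_simps)
qed

lemma has_bochner_integral_beta_kernel:
  assumes "lo < hi" "Re \<alpha> > 0" "Re \<beta> > 0"
  shows "has_bochner_integral lborel (beta_kernel lo hi \<alpha> \<beta>)
    (complex_of_real (hi - lo) powr (\<alpha> + \<beta> - 1) * (Gamma \<alpha> * Gamma \<beta> / Gamma (\<alpha> + \<beta>)))"
  using has_bochner_integral_beta_kernel_scaled[OF assms] integral_beta_kernel_01[OF assms(2,3)] by simp

section \<open>Growth of the Gamma function along an arithmetic progression\<close>

lemma of_real_powr_times_of_nat:
  "x > 0 \<Longrightarrow> complex_of_real x powr (u * of_nat n) = (complex_of_real x powr u) ^ n"
  by (simp add: powr_def exp_of_nat_mult[symmetric] mult_ac)

lemma beta_kernel_shift_exponent: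
  "beta_kernel lo hi \<alpha> (\<beta> + u * of_nat n) x =
     beta_kernel lo hi \<alpha> \<beta> x * complex_of_real (x - lo) powr (u * of_nat n)"
proof -
  have "\<beta> + u * of_nat n - 1 = (\<beta> - 1) + u * of_nat n" by simp
  hence "w powr (\<beta> + u * of_nat n - 1) = w powr (\<beta> - 1) * w powr (u * of_nat n)" for w :: complex
    by (simp only: powr_add)
  thus ?thesis unfolding beta_kernel_def by (simp only: mult_scaleR_left mult.assoc)
qed

lemma norm_beta_kernel_shift_le:
  assumes "Re u \<ge> 0" "lo < hi"
  shows "norm (beta_kernel lo hi \<alpha> (\<beta> + u * of_nat n) x) \<le>
           ((hi - lo) powr Re u) ^ n * norm (beta_kernel lo hi \<alpha> \<beta> x)"
proof (cases "lo < x \<and> x < hi")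
  case True
  hence "norm (complex_of_real (x - lo) powr (u * of_nat n)) = ((x - lo) powr Re u) ^ n"
    by (simp add: of_real_powr_times_of_nat norm_power norm_of_real_powr del: of_real_diff)
  also have "\<dots> \<le> ((hi - lo) powr Re u) ^ n"
    using True assms by (intro power_mono powr_mono2) auto
  finally show ?thesis unfolding beta_kernel_shift_exponent norm_mult
    by (subst mult.commute) (rule mult_right_mono, auto)
qed (auto simp: beta_kernel_def)

text \<open>
  At a point \<open>x\<close> of the unit interval the integrand is the one for \<open>n = 0\<close> times the
  \<open>n\<close>-th power of \<open>x powr u\<close>, whose modulus is less than 1, so dominated
  convergence applies with the integrand for \<open>n = 0\<close> as majorant.
\<close>
lemma integral_beta_kernel_tendsto_0:
  assumes "Re q > 0" "Re u > 0"
  shows "(\<lambda>n. \<integral>x. beta_kernel 0 1 u (q + u * of_nat n) x \<partial>lborel) \<longlonglongrightarrow> 0"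
proof -
  have "(\<lambda>n. \<integral>x. beta_kernel 0 1 u (q + u * of_nat n) x \<partial>lborel) \<longlonglongrightarrow> integral\<^sup>L (lborel :: real measure) (\<lambda>x. 0)"
  proof (rule integral_dominated_convergence)
    show "integrable lborel (\<lambda>x. norm (beta_kernel 0 1 u q x))"
      using assms by (intro integrable_norm integrable_beta_kernel_01)
    show "AE x in lborel. norm (beta_kernel 0 1 u (q + u * of_nat n) x) \<le> norm (beta_kernel 0 1 u q x)" for n
      using norm_beta_kernel_shift_le[of u 0 1 u q n] assms by (intro always_eventually) auto
    have "(\<lambda>n. beta_kernel 0 1 u (q + u * of_nat n) x) \<longlonglongrightarrow> 0" for x
    proof (cases "0 < x \<and> x < 1")
      case True
      hence "norm (complex_of_real x powr u) < 1"
        using powr_less_mono2[of "Re u" x 1] assms by (simp add: norm_of_real_powr)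
      hence "(\<lambda>n. beta_kernel 0 1 u q x * (complex_of_real x powr u) ^ n) \<longlonglongrightarrow> beta_kernel 0 1 u q x * 0"
        by (intro tendsto_mult_left LIMSEQ_power_zero)
      thus ?thesis using True
        by (simp add: beta_kernel_shift_exponent of_real_powr_times_of_nat)
    qed (auto simp: beta_kernel_def)
    thus "AE x in lborel. (\<lambda>n. beta_kernel 0 1 u (q + u * of_nat n) x) \<longlonglongrightarrow> 0"
      by (intro always_eventually) auto
  qed measurable
  thus ?thesis by simp
qed

text \<open>
  The ratio \<open>Gamma (q + u * n) / Gamma (q + u * (n + 1))\<close> is the Beta integral with exponents
  \<open>u\<close> and \<open>q + u * n\<close> divided by \<open>Gamma u\<close>, and this Beta integral tends to 0. The ratio
  test then gives convergence for every \<open>K\<close>.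
\<close>
lemma summable_power_over_Gamma:
  fixes q u :: complex and K :: real
  assumes q: "Re q > 0" and u: "Re u > 0" and K: "K \<ge> 0"
  shows "summable (\<lambda>n. K ^ n / norm (Gamma (q + u * of_nat n)))"
proof -
  define b where "b = (\<lambda>n. \<integral>x. beta_kernel 0 1 u (q + u * of_nat n) x \<partial>lborel)"
  have Gu: "Gamma u \<noteq> 0" using u by (rule Gamma_nonzero_if_Re_pos)
  have step: "norm (K ^ Suc n / norm (Gamma (q + u * of_nat (Suc n)))) =
      (K * norm (b n) / norm (Gamma u)) * norm (K ^ n / norm (Gamma (q + u * of_nat n)))" for n
  proof -
    have pos: "Re (q + u * of_nat n) > 0" using q u by (simp add: add_pos_nonneg)
    have "b n = Gamma u * Gamma (q + u * of_nat n) / Gamma (u + (q + u * of_nat n))"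
      unfolding b_def by (rule integral_beta_kernel_01[OF u pos])
    moreover have "u + (q + u * of_nat n) = q + u * of_nat (Suc n)" by (simp add: algebra_simps)
    ultimately show ?thesis
      using Gu Gamma_nonzero_if_Re_pos[OF pos] K
      by (simp add: norm_mult norm_divide norm_power field_simps del: of_nat_Suc)
  qed
  have "(\<lambda>n. K * norm (b n) / norm (Gamma u)) \<longlonglongrightarrow> K * norm (0 :: complex) / norm (Gamma u)"
    unfolding b_def using Gu integral_beta_kernel_tendsto_0[OF q u] by (intro tendsto_intros) auto
  hence "eventually (\<lambda>n. K * norm (b n) / norm (Gamma u) < 1 / 2) sequentially"
    by (rule order_tendstoD) simp
  then obtain N where N: "\<And>n. n \<ge> N \<Longrightarrow> K * norm (b n) / norm (Gamma u) < 1 / 2"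
    by (auto simp: eventually_sequentially)
  show ?thesis
  proof (rule summable_ratio_test[of "1/2" N])
    fix n assume "n \<ge> N"
    thus "norm (K ^ Suc n / norm (Gamma (q + u * of_nat (Suc n)))) \<le> 1 / 2 * norm (K ^ n / norm (Gamma (q + u * of_nat n)))"
      unfolding step using N[of n] by (intro mult_right_mono) auto
  qed simp
qed

section \<open>Coefficients of the double series\<close>

text \<open>
  Each factor satisfies \<open>\<bar>s + k\<bar> \<le> (\<bar>s\<bar> + 1) * (k + 1)\<close>.
\<close>
lemma pochhammer_upper_bound:
  fixes s :: complex
  shows "norm (pochhammer s k) \<le> (norm s + 1) ^ k * fact k"
proof (induction k)
  case (Suc k)
  have "norm (s + of_nat k) \<le> norm s + real k"
    using norm_triangle_ineq[of s "of_nat k"] by simp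
  also have "\<dots> \<le> (norm s + 1) * (real k + 1)"
    by (simp add: algebra_simps)
  finally have "norm (pochhammer s k) * norm (s + of_nat k)
      \<le> ((norm s + 1) ^ k * fact k) * ((norm s + 1) * (real k + 1))"
    by (intro mult_mono Suc.IH) auto
  thus ?case by (simp add: pochhammer_Suc norm_mult mult_ac add_ac)
qed simp

text \<open>
  The quotients \<open>\<bar>s + k\<bar> / (k + 1)\<close> are all nonzero, because \<open>s\<close> is no pole of the Gamma
  function, and they tend to 1; hence they have a positive lower bound.
\<close>
lemma pochhammer_lower_bound:
  fixes s :: complex
  assumes "s \<notin> \<int>\<^sub>\<le>\<^sub>0"
  obtains \<delta> where "\<delta> > 0" "\<And>k. \<delta> ^ k * fact k \<le> norm (pochhammer s k)"
proof -
  have "(\<lambda>k. norm (s / of_nat (Suc k) + of_nat k / of_nat (Suc k))) \<longlonglongrightarrow> norm (0 + 1 :: complex)"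
    by (intro tendsto_norm tendsto_add lim_const_over_n[THEN LIMSEQ_Suc] LIMSEQ_n_over_Suc_n)
  also have "(\<lambda>k. norm (s / of_nat (Suc k) + of_nat k / of_nat (Suc k))) =
      (\<lambda>k. norm (s + of_nat k) / real (Suc k))"
    by (simp only: add_divide_distrib[symmetric] norm_divide norm_of_nat)
  finally have lim: "(\<lambda>k. norm (s + of_nat k) / real (Suc k)) \<longlonglongrightarrow> 1" by simp
  \<comment> \<open>From some index on the quotients exceed 1/2, and only finitely many others remain.\<close>
  have "eventually (\<lambda>k. norm (s + of_nat k) / real (Suc k) > 1 / 2) sequentially"
    by (rule order_tendstoD[OF lim]) simp
  then obtain N where N: "\<And>k. k \<ge> N \<Longrightarrow> norm (s + of_nat k) / real (Suc k) > 1 / 2"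
    by (auto simp: eventually_sequentially)
  define \<delta> where "\<delta> = Min (insert (1/2) ((\<lambda>k. norm (s + of_nat k) / real (Suc k)) ` {..<N}))"
  have nz: "s + of_nat k \<noteq> 0" for k
    using assms by (metis minus_of_nat_in_nonpos_Ints minus_minus add.inverse_unique)
  have "\<delta> > 0" unfolding \<delta>_def using nz by (subst Min_gr_iff) auto
  have \<delta>: "\<delta> * real (Suc k) \<le> norm (s + of_nat k)" for k
  proof -
    have "\<delta> \<le> norm (s + of_nat k) / real (Suc k)"
    proof (cases "k < N")
      case False
      have "\<delta> \<le> 1/2" unfolding \<delta>_def by (rule Min_le) auto
      with N[of k] False show ?thesis by linarith
    qed (auto simp: \<delta>_def intro!: Min_le)
    thus ?thesis by (simp add: pos_le_divide_eq del: of_nat_Suc)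
  qed
  have "\<delta> ^ k * fact k \<le> norm (pochhammer s k)" for k
  proof (induction k)
    case (Suc k)
    have "(\<delta> ^ k * fact k) * (\<delta> * real (Suc k)) \<le> norm (pochhammer s k) * norm (s + of_nat k)"
      using \<open>\<delta> > 0\<close> by (intro mult_mono Suc.IH \<delta>) auto
    thus ?case by (simp add: pochhammer_Suc norm_mult mult_ac del: of_nat_Suc)
  qed simp
  with \<open>\<delta> > 0\<close> show ?thesis using that by blast
qed

lemma fact_add_le: "fact (l + n) \<le> (2::real) ^ (l + n) * (fact l * fact n)"
proof -
  have "real ((l + n) choose l) \<le> 2 ^ (l + n)"
    using binomial_le_pow2[of "l + n" l] by (metis of_nat_le_iff of_nat_numeral of_nat_power)
  moreover have "real ((l + n) choose l) = fact (l + n) / (fact l * fact n)"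
    by (simp add: binomial_fact)
  ultimately show ?thesis by (simp add: pos_divide_le_eq)
qed

text \<open>
  The coefficient of the double series stripped of its two Gamma values. These alone contain
  \<open>p\<close> and \<open>q\<close>, the parameters that fractional integration changes.
\<close>
definition konhauser_coeff ::
  "complex \<Rightarrow> complex \<Rightarrow> complex \<Rightarrow> complex \<Rightarrow> complex \<Rightarrow> complex \<Rightarrow> nat \<Rightarrow> nat \<Rightarrow> complex" where
  "konhauser_coeff \<gamma>1 \<gamma>2 \<gamma>3 \<gamma>4 \<gamma>5 \<gamma>6 l n =
     (- 1) ^ l * pochhammer \<gamma>1 (2 * l) * pochhammer \<gamma>2 (l + n) * pochhammer \<gamma>3 l
       / (pochhammer \<gamma>4 l * pochhammer \<gamma>5 l * pochhammer \<gamma>6 l * fact n * fact l)"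

text \<open>
  Up to geometric factors, the Pochhammer symbols in the numerator are at most factorials and
  those in the denominator at least factorials; moreover \<open>fact (2 * l)\<close> is at most
  \<open>(fact l)\<^sup>2\<close> and \<open>fact (l + n)\<close> at most \<open>fact l * fact n\<close>. Both bounds then
  contain \<open>fact l\<close> four times and \<open>fact n\<close> once, and all factorials cancel.
\<close>
lemma konhauser_coeff_bound:
  assumes "\<gamma>4 \<notin> \<int>\<^sub>\<le>\<^sub>0" "\<gamma>5 \<notin> \<int>\<^sub>\<le>\<^sub>0" "\<gamma>6 \<notin> \<int>\<^sub>\<le>\<^sub>0"
  obtains K L where "K \<ge> 0" "L \<ge> 0"
    "\<And>l n. norm (konhauser_coeff \<gamma>1 \<gamma>2 \<gamma>3 \<gamma>4 \<gamma>5 \<gamma>6 l n) \<le> K ^ l * L ^ n"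
proof -
  obtain \<delta>4 where \<delta>4: "\<delta>4 > 0" "\<And>k. \<delta>4 ^ k * fact k \<le> norm (pochhammer \<gamma>4 k)"
    using pochhammer_lower_bound[OF assms(1)] by blast
  obtain \<delta>5 where \<delta>5: "\<delta>5 > 0" "\<And>k. \<delta>5 ^ k * fact k \<le> norm (pochhammer \<gamma>5 k)"
    using pochhammer_lower_bound[OF assms(2)] by blast
  obtain \<delta>6 where \<delta>6: "\<delta>6 > 0" "\<And>k. \<delta>6 ^ k * fact k \<le> norm (pochhammer \<gamma>6 k)"
    using pochhammer_lower_bound[OF assms(3)] by blast
  define c1 c2 c3 where "c1 = norm \<gamma>1 + 1" and "c2 = norm \<gamma>2 + 1" and "c3 = norm \<gamma>3 + 1"
  have c: "c1 \<ge> 0" "c2 \<ge> 0" "c3 \<ge> 0" by (auto simp: c1_def c2_def c3_def)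
  define K where "K = 8 * c1\<^sup>2 * c2 * c3 / (\<delta>4 * \<delta>5 * \<delta>6)"
  define L where "L = 2 * c2"
  have "norm (konhauser_coeff \<gamma>1 \<gamma>2 \<gamma>3 \<gamma>4 \<gamma>5 \<gamma>6 l n) \<le> K ^ l * L ^ n" for l n
  proof -
    have 1: "norm (pochhammer \<gamma>1 (2 * l)) \<le> c1 ^ (2 * l) * (2 ^ (2 * l) * (fact l * fact l))"
      using pochhammer_upper_bound[of \<gamma>1 "2 * l"] fact_add_le[of l l] c
      by (intro order.trans[OF pochhammer_upper_bound[of \<gamma>1 "2 * l"]] mult_mono)
         (auto simp: c1_def mult_2)
    have 2: "norm (pochhammer \<gamma>2 (l + n)) \<le> c2 ^ (l + n) * (2 ^ (l + n) * (fact l * fact n))"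
      using fact_add_le[of l n] c
      by (intro order.trans[OF pochhammer_upper_bound[of \<gamma>2 "l + n"]] mult_mono) (auto simp: c2_def)
    have 3: "norm (pochhammer \<gamma>3 l) \<le> c3 ^ l * fact l"
      using pochhammer_upper_bound[of \<gamma>3 l] by (simp add: c3_def)
    have "norm (konhauser_coeff \<gamma>1 \<gamma>2 \<gamma>3 \<gamma>4 \<gamma>5 \<gamma>6 l n) =
        norm (pochhammer \<gamma>1 (2 * l)) * norm (pochhammer \<gamma>2 (l + n)) * norm (pochhammer \<gamma>3 l) /
        (norm (pochhammer \<gamma>4 l) * norm (pochhammer \<gamma>5 l) * norm (pochhammer \<gamma>6 l) * fact n * fact l)"
      by (simp add: konhauser_coeff_def norm_mult norm_divide norm_power)
    also have "\<dots> \<le> (c1 ^ (2 * l) * (2 ^ (2 * l) * (fact l * fact l))) *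
        (c2 ^ (l + n) * (2 ^ (l + n) * (fact l * fact n))) * (c3 ^ l * fact l) /
        ((\<delta>4 ^ l * fact l) * (\<delta>5 ^ l * fact l) * (\<delta>6 ^ l * fact l) * fact n * fact l)"
      using c \<delta>4 \<delta>5 \<delta>6 by (intro frac_le mult_mono 1 2 3) auto
    also have "\<dots> = K ^ l * L ^ n"
    proof -
      have "(8::real) ^ l = 2 ^ (2 * l) * 2 ^ l" by (simp add: power_mult flip: power_mult_distrib)
      moreover have "(c1 ^ l)\<^sup>2 = c1\<^sup>2 ^ l" by (simp add: mult.commute flip: power_mult)
      ultimately show ?thesis using \<delta>4 \<delta>5 \<delta>6
        by (simp add: K_def L_def power_add power_mult field_simps)
    qed
    finally show ?thesis .
  qed
  moreover have "K \<ge> 0" "L \<ge> 0" using c \<delta>4 \<delta>5 \<delta>6 by (auto simp: K_def L_def)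
  ultimately show ?thesis using that by blast
qed

section \<open>Termwise integration\<close>

text \<open>
  Weierstrass's test for integrals: a majorant that splits into a summable sequence and one
  integrable function gives termwise integration and a pointwise bound for the sum, so that
  the lemma can be applied again to a series of such sums.
\<close>
lemma integral_dominated_series:
  fixes f :: "nat \<Rightarrow> 'a \<Rightarrow> complex" and \<Phi> :: "'a \<Rightarrow> real"
  assumes [measurable]: "\<And>i. f i \<in> borel_measurable M"
    and \<Phi>: "integrable M \<Phi>"
    and bound: "\<And>i x. norm (f i x) \<le> m i * \<Phi> x"
    and m: "summable m" "\<And>i. m i \<ge> 0"
    and nn: "\<And>x. \<Phi> x \<ge> 0"
  shows "integrable M (\<lambda>x. \<Sum>i. f i x)"
    and "(\<lambda>i. integral\<^sup>L M (f i)) sums (\<integral>x. (\<Sum>i. f i x) \<partial>M)"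
    and "\<And>x. summable (\<lambda>i. norm (f i x))"
    and "\<And>x. norm (\<Sum>i. f i x) \<le> suminf m * \<Phi> x"
proof -
  have int: "integrable M (f i)" for i
    using bound nn m(2) by (intro Bochner_Integration.integrable_bound[OF integrable_mult_right[OF \<Phi>, of "m i"]]) auto
  have sm: "summable (\<lambda>i. m i * \<Phi> x)" for x by (intro summable_mult2 m)
  show sum: "summable (\<lambda>i. norm (f i x))" for x
    by (rule summable_comparison_test[OF _ sm]) (use bound in auto)
  have "(\<integral>x. norm (f i x) \<partial>M) \<le> m i * integral\<^sup>L M \<Phi>" for i
  proof -
    have "(\<integral>x. norm (f i x) \<partial>M) \<le> (\<integral>x. m i * \<Phi> x \<partial>M)"
      by (intro integral_mono integrable_norm int integrable_mult_right \<Phi> bound)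
    thus ?thesis by simp
  qed
  hence summ: "summable (\<lambda>i. \<integral>x. norm (f i x) \<partial>M)"
    by (intro summable_comparison_test[OF _ summable_mult2[OF m(1), of "integral\<^sup>L M \<Phi>"]]) auto
  show "integrable M (\<lambda>x. \<Sum>i. f i x)"
    using sum by (intro integrable_suminf int summ) auto
  show "(\<lambda>i. integral\<^sup>L M (f i)) sums (\<integral>x. (\<Sum>i. f i x) \<partial>M)"
    using sum by (intro sums_integral int summ) auto
  show "norm (\<Sum>i. f i x) \<le> suminf m * \<Phi> x" for x
  proof -
    have "norm (\<Sum>i. f i x) \<le> (\<Sum>i. m i * \<Phi> x)"
      by (rule norm_suminf_le[OF bound sm])
    thus ?thesis by (simp add: suminf_mult2[OF m(1)])
  qed
qed

lemma (in pair_sigma_finite) integrable_product_mult: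
  fixes f :: "'a \<Rightarrow> 'c::{real_normed_field, banach, second_countable_topology}"
  assumes "integrable M1 f" "integrable M2 g"
  shows "integrable (M1 \<Otimes>\<^sub>M M2) (\<lambda>(x, y). f x * g y)"
    and "integral\<^sup>L (M1 \<Otimes>\<^sub>M M2) (\<lambda>(x, y). f x * g y) = integral\<^sup>L M1 f * integral\<^sup>L M2 g"
proof -
  note [measurable] = assms[THEN borel_measurable_integrable]
  show *: "integrable (M1 \<Otimes>\<^sub>M M2) (\<lambda>(x, y). f x * g y)"
  proof (rule Fubini_integrable)
    show "integrable M1 (\<lambda>x. \<integral>y. norm (case (x, y) of (x, y) \<Rightarrow> f x * g y) \<partial>M2)"
      using assms by (simp add: norm_mult)
    show "AE x in M1. integrable M2 (\<lambda>y. case (x, y) of (x, y) \<Rightarrow> f x * g y)"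
      using assms by simp
  qed measurable
  show "integral\<^sup>L (M1 \<Otimes>\<^sub>M M2) (\<lambda>(x, y). f x * g y) = integral\<^sup>L M1 f * integral\<^sup>L M2 g"
    using integral_fst[OF *] assms by simp
qed

text \<open>
  For fixed \<open>l\<close> the sum over \<open>n\<close> depends on \<open>y\<close> only; it is integrated termwise on the second
  factor. The sum over \<open>l\<close> is integrated termwise on the product space, where each term is a
  product of a function of \<open>x\<close> and one of \<open>y\<close>. Since the coefficients are bounded by a product
  \<open>\<alpha> l * \<beta> n\<close>, both steps reduce to single series.
\<close>
lemma (in pair_sigma_finite) integral_dominated_double_series:
  fixes \<phi> :: "nat \<Rightarrow> 'a \<Rightarrow> complex" and \<psi> :: "nat \<Rightarrow> 'b \<Rightarrow> complex" and A :: "nat \<Rightarrow> nat \<Rightarrow> complex"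
    and \<alpha> \<beta> m k :: "nat \<Rightarrow> real"
  assumes \<phi>: "\<And>l. integrable M1 (\<phi> l)" and \<psi>: "\<And>n. integrable M2 (\<psi> n)"
    and \<Phi>: "integrable M1 \<Phi>" "\<And>x. \<Phi> x \<ge> 0" and \<Psi>: "integrable M2 \<Psi>" "\<And>y. \<Psi> y \<ge> 0"
    and m: "\<And>l x. norm (\<phi> l x) \<le> m l * \<Phi> x" "\<And>l. m l \<ge> 0"
    and k: "\<And>n y. norm (\<psi> n y) \<le> k n * \<Psi> y" "\<And>n. k n \<ge> 0"
    and A: "\<And>l n. norm (A l n) \<le> \<alpha> l * \<beta> n" "\<And>l. \<alpha> l \<ge> 0" "\<And>n. \<beta> n \<ge> 0"
    and summ: "summable (\<lambda>l. \<alpha> l * m l)" "summable (\<lambda>n. \<beta> n * k n)"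
  defines "F \<equiv> \<lambda>x y. \<Sum>l. \<Sum>n. A l n * \<phi> l x * \<psi> n y"
  shows "\<And>l x y. summable (\<lambda>n. A l n * \<phi> l x * \<psi> n y)"
    and "\<And>x y. summable (\<lambda>l. \<Sum>n. A l n * \<phi> l x * \<psi> n y)"
    and "integrable (M1 \<Otimes>\<^sub>M M2) (\<lambda>(x, y). F x y)"
    and "\<And>l. summable (\<lambda>n. A l n * integral\<^sup>L M1 (\<phi> l) * integral\<^sup>L M2 (\<psi> n))"
    and "(\<lambda>l. \<Sum>n. A l n * integral\<^sup>L M1 (\<phi> l) * integral\<^sup>L M2 (\<psi> n)) sums
           (\<integral>y. (\<integral>x. F x y \<partial>M1) \<partial>M2)"
proof -
  note [measurable] = borel_measurable_integrable[OF \<phi>] borel_measurable_integrable[OF \<psi>]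
    borel_measurable_integrable[OF \<Phi>(1)] borel_measurable_integrable[OF \<Psi>(1)]
  define h where "h = (\<lambda>l y. \<Sum>n. A l n * \<psi> n y)"
  define S where "S = (\<Sum>n. \<beta> n * k n)"
  have inner: "integrable M2 (h l)"
    "(\<lambda>n. integral\<^sup>L M2 (\<lambda>y. A l n * \<psi> n y)) sums integral\<^sup>L M2 (h l)"
    "\<And>y. summable (\<lambda>n. norm (A l n * \<psi> n y))"
    "\<And>y. norm (h l y) \<le> (\<Sum>n. \<alpha> l * (\<beta> n * k n)) * \<Psi> y" for l
  proof -
    have bd: "norm (A l n * \<psi> n y) \<le> (\<alpha> l * (\<beta> n * k n)) * \<Psi> y" for n y
      using mult_mono[OF A(1)[of l n] k(1)[of n y]] A(2,3) by (simp add: norm_mult mult_ac)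
    note * = integral_dominated_series[of "\<lambda>n y. A l n * \<psi> n y" M2 \<Psi> "\<lambda>n. \<alpha> l * (\<beta> n * k n)",
        OF _ \<Psi>(1) bd summable_mult[OF summ(2)] _ \<Psi>(2)]
    show "integrable M2 (h l)"
      "(\<lambda>n. integral\<^sup>L M2 (\<lambda>y. A l n * \<psi> n y)) sums integral\<^sup>L M2 (h l)"
      "\<And>y. summable (\<lambda>n. norm (A l n * \<psi> n y))"
      "\<And>y. norm (h l y) \<le> (\<Sum>n. \<alpha> l * (\<beta> n * k n)) * \<Psi> y"
      unfolding h_def by (rule *; simp add: A k)+
  qed
  have h_bound: "norm (h l y) \<le> \<alpha> l * S * \<Psi> y" for l y
    using inner(4)[of l y] by (simp add: suminf_mult summ(2) S_def)
  have S: "S \<ge> 0" unfolding S_def using A k by (intro suminf_nonneg summ) auto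
  note [measurable] = borel_measurable_integrable[OF inner(1)]
  have row: "(\<lambda>n. A l n * \<phi> l x * \<psi> n y) sums (\<phi> l x * h l y)" for l x y
    using sums_mult[OF summable_sums[OF summable_norm_cancel[OF inner(3)[of l y]]], of "\<phi> l x"]
    by (simp add: h_def mult_ac)
  have F_eq: "F x y = (\<Sum>l. \<phi> l x * h l y)" for x y
    unfolding F_def by (simp add: sums_unique[OF row, symmetric])
  have bd: "norm (\<phi> l x * h l y) \<le> (\<alpha> l * m l * S) * (\<Phi> x * \<Psi> y)" for l x y
    using mult_mono[OF m(1)[of l x] h_bound[of l y]] m \<Phi> by (simp add: norm_mult mult_ac)
  note outer = integral_dominated_series[of "\<lambda>l (x, y). \<phi> l x * h l y" "M1 \<Otimes>\<^sub>M M2"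
      "\<lambda>(x, y). \<Phi> x * \<Psi> y" "\<lambda>l. \<alpha> l * m l * S", OF _ integrable_product_mult(1)[OF \<Phi>(1) \<Psi>(1)]]
  have prem: "\<And>i. (\<lambda>(x, y). \<phi> i x * h i y) \<in> borel_measurable (M1 \<Otimes>\<^sub>M M2)"
    by measurable
  have prems2: "\<And>l p. norm (case p of (x, y) \<Rightarrow> \<phi> l x * h l y) \<le> \<alpha> l * m l * S * (case p of (x, y) \<Rightarrow> \<Phi> x * \<Psi> y)"
    "summable (\<lambda>l. \<alpha> l * m l * S)" "\<And>l. \<alpha> l * m l * S \<ge> 0" "\<And>p. (case p of (x, y) \<Rightarrow> \<Phi> x * \<Psi> y) \<ge> 0"
    using bd A m S \<Phi> \<Psi> by (auto intro: summable_mult2 summ)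
  note outer = outer[OF prem prems2]
  have F_prod: "(\<lambda>p. \<Sum>l. case p of (x, y) \<Rightarrow> \<phi> l x * h l y) = (\<lambda>(x, y). F x y)"
    by (auto simp: F_eq fun_eq_iff)
  show int: "integrable (M1 \<Otimes>\<^sub>M M2) (\<lambda>(x, y). F x y)"
    using outer(1) unfolding F_prod .
  show "summable (\<lambda>n. A l n * \<phi> l x * \<psi> n y)" for l x y
    using row by (rule sums_summable)
  show "summable (\<lambda>l. \<Sum>n. A l n * \<phi> l x * \<psi> n y)" for x y
    using outer(3)[of "(x, y)"] by (simp add: sums_unique[OF row, symmetric] summable_norm_cancel)
  have Irow: "(\<lambda>n. A l n * integral\<^sup>L M1 (\<phi> l) * integral\<^sup>L M2 (\<psi> n)) sums
      (integral\<^sup>L M1 (\<phi> l) * integral\<^sup>L M2 (h l))" for l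
    using sums_mult[OF inner(2)[of l], of "integral\<^sup>L M1 (\<phi> l)"] by (simp add: mult_ac)
  show "summable (\<lambda>n. A l n * integral\<^sup>L M1 (\<phi> l) * integral\<^sup>L M2 (\<psi> n))" for l
    using Irow by (rule sums_summable)
  have "(\<lambda>l. integral\<^sup>L M1 (\<phi> l) * integral\<^sup>L M2 (h l)) sums integral\<^sup>L (M1 \<Otimes>\<^sub>M M2) (\<lambda>(x, y). F x y)"
    using outer(2) unfolding F_prod integrable_product_mult(2)[OF \<phi> inner(1)] .
  also have "integral\<^sup>L (M1 \<Otimes>\<^sub>M M2) (\<lambda>(x, y). F x y) = (\<integral>y. (\<integral>x. F x y \<partial>M1) \<partial>M2)"
    using integral_snd[OF int] by simp
  finally show "(\<lambda>l. \<Sum>n. A l n * integral\<^sup>L M1 (\<phi> l) * integral\<^sup>L M2 (\<psi> n)) sums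
           (\<integral>y. (\<integral>x. F x y \<partial>M1) \<partial>M2)"
    by (simp add: sums_unique[OF Irow, symmetric])
qed

text \<open>
  Convergence is assumed after multiplication by \<open>c\<close>, the form in which termwise integration
  delivers it.
\<close>
lemma suminf_cmult_of_summable:
  fixes f :: "nat \<Rightarrow> complex"
  assumes "c \<noteq> 0" "summable (\<lambda>n. c * f n)"
  shows "c * suminf f = (\<Sum>n. c * f n)"
  using suminf_mult[of f c] assms by simp

lemma double_suminf_cmult_of_summable:
  fixes f :: "nat \<Rightarrow> nat \<Rightarrow> complex"
  assumes "c \<noteq> 0" "\<And>l. summable (\<lambda>n. c * f l n)" "summable (\<lambda>l. \<Sum>n. c * f l n)"
  shows "c * (\<Sum>l. \<Sum>n. f l n) = (\<Sum>l. \<Sum>n. c * f l n)"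
proof -
  have "(\<lambda>l. \<Sum>n. c * f l n) = (\<lambda>l. c * (\<Sum>n. f l n))"
    using suminf_cmult_of_summable[OF assms(1,2)] by simp
  thus ?thesis using suminf_cmult_of_summable[OF assms(1), of "\<lambda>l. \<Sum>n. f l n"] assms(3) by simp
qed

section \<open>Fractional integration of the I-Konhauser Mittag-Leffler function\<close>

theorem theorem48:
  fixes p q \<upsilon> \<gamma>1 \<gamma>2 \<gamma>3 \<gamma>4 \<gamma>5 \<gamma>6 \<sigma> \<tau> w1 w2 c :: complex
    and a b z t :: real
  assumes "Re p > 0" and "Re q > 0" and "Re \<upsilon> > 0"
    and "\<gamma>4 \<notin> \<int>\<^sub>\<le>\<^sub>0" and "\<gamma>5 \<notin> \<int>\<^sub>\<le>\<^sub>0" and "\<gamma>6 \<notin> \<int>\<^sub>\<le>\<^sub>0"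
    and "Re \<sigma> > 0" and "Re \<tau> > 0"
    and "z > a" and "t > b"
    and "powr_value w2 \<upsilon> c"
  defines "d \<equiv> \<lambda>\<xi> y. complex_of_real (\<xi> - a) powr (p - 1) * complex_of_real (y - b) powr (q - 1)
                  * konhauser_ML \<gamma>1 \<gamma>2 \<gamma>3 \<gamma>4 \<gamma>5 \<gamma>6 p q \<upsilon> (w1 * complex_of_real (\<xi> - a)) c (y - b)"
  shows "RL_integrable a b \<sigma> \<tau> d z t \<and>
         RL_integral a b \<sigma> \<tau> d z t =
           complex_of_real (z - a) powr (p + \<sigma> - 1) * complex_of_real (t - b) powr (q + \<tau> - 1)
             * konhauser_ML \<gamma>1 \<gamma>2 \<gamma>3 \<gamma>4 \<gamma>5 \<gamma>6 (p + \<sigma>) (q + \<tau>) \<upsilon>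
                 (w1 * complex_of_real (z - a)) c (t - b)"
proof -
  note pos = assms(1-3,7,8) and za = assms(9) and tb = assms(10)
  let ?C = "konhauser_coeff \<gamma>1 \<gamma>2 \<gamma>3 \<gamma>4 \<gamma>5 \<gamma>6"
  obtain K L where KL: "K \<ge> 0" "L \<ge> 0" and C: "\<And>l n. norm (?C l n) \<le> K ^ l * L ^ n"
    using konhauser_coeff_bound[OF assms(4-6)] by blast
  define \<phi> where "\<phi> = (\<lambda>l::nat. beta_kernel a z \<sigma> (p + of_nat l))"
  define \<psi> where "\<psi> = (\<lambda>n::nat. beta_kernel b t \<tau> (q + \<upsilon> * of_nat n))"
  define A where "A = (\<lambda>l n. ?C l n * w1 ^ l * c ^ n / (Gamma (p + of_nat l) * Gamma (q + \<upsilon> * of_nat n)))"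
  \<comment> \<open>The summand for \<open>l\<close>, \<open>n\<close> is at most \<open>\<alpha> l * m l * (\<beta> n * k n)\<close> times the integrand of the lowest term.\<close>
  define \<Phi> where "\<Phi> = (\<lambda>x. norm (beta_kernel a z \<sigma> p x))"
  define \<Psi> where "\<Psi> = (\<lambda>y. norm (beta_kernel b t \<tau> q y))"
  define m k where "m = (\<lambda>l::nat. (z - a) ^ l)" and "k = (\<lambda>n::nat. ((t - b) powr Re \<upsilon>) ^ n)"
  define \<alpha> where "\<alpha> = (\<lambda>l::nat. (K * norm w1) ^ l / norm (Gamma (p + of_nat l)))"
  define \<beta> where "\<beta> = (\<lambda>n::nat. (L * norm c) ^ n / norm (Gamma (q + \<upsilon> * of_nat n)))"
  have p_pos: "Re (p + of_nat l) > 0" and q_pos: "Re (q + \<upsilon> * of_nat l) > 0" for l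
    using pos by (auto intro: add_pos_nonneg)
  have \<phi>_int: "has_bochner_integral lborel (\<phi> l) (complex_of_real (z - a) powr (\<sigma> + (p + of_nat l) - 1) *
      (Gamma \<sigma> * Gamma (p + of_nat l) / Gamma (\<sigma> + (p + of_nat l))))" for l
    unfolding \<phi>_def by (rule has_bochner_integral_beta_kernel[OF za pos(4) p_pos])
  have \<psi>_int: "has_bochner_integral lborel (\<psi> n) (complex_of_real (t - b) powr (\<tau> + (q + \<upsilon> * of_nat n) - 1) *
      (Gamma \<tau> * Gamma (q + \<upsilon> * of_nat n) / Gamma (\<tau> + (q + \<upsilon> * of_nat n))))" for n
    unfolding \<psi>_def by (rule has_bochner_integral_beta_kernel[OF tb pos(5) q_pos])
  have prems: "integrable lborel \<Phi>" "\<And>x. \<Phi> x \<ge> 0" "integrable lborel \<Psi>" "\<And>x. \<Psi> x \<ge> 0"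
    "\<And>l x. norm (\<phi> l x) \<le> m l * \<Phi> x" "\<And>l. m l \<ge> 0"
    "\<And>n y. norm (\<psi> n y) \<le> k n * \<Psi> y" "\<And>n. k n \<ge> 0"
    "\<And>l n. norm (A l n) \<le> \<alpha> l * \<beta> n" "\<And>l. \<alpha> l \<ge> 0" "\<And>n. \<beta> n \<ge> 0"
    "summable (\<lambda>l. \<alpha> l * m l)" "summable (\<lambda>n. \<beta> n * k n)"
  proof -
    show "integrable lborel \<Phi>" "integrable lborel \<Psi>"
      using \<phi>_int[of 0] \<psi>_int[of 0]
      by (auto simp: \<Phi>_def \<Psi>_def \<phi>_def \<psi>_def has_bochner_integral_iff)
    show "norm (\<phi> l x) \<le> m l * \<Phi> x" for l x
      using norm_beta_kernel_shift_le[of 1 a z \<sigma> p l x] za by (simp add: \<phi>_def m_def \<Phi>_def)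
    show "norm (\<psi> n y) \<le> k n * \<Psi> y" for n y
      using norm_beta_kernel_shift_le[of \<upsilon> b t \<tau> q n y] tb pos by (simp add: \<psi>_def k_def \<Psi>_def)
    show "norm (A l n) \<le> \<alpha> l * \<beta> n" for l n
    proof -
      have "norm (A l n) = norm (?C l n) * (norm w1 ^ l * norm c ^ n /
          (norm (Gamma (p + of_nat l)) * norm (Gamma (q + \<upsilon> * of_nat n))))"
        by (simp add: A_def norm_mult norm_divide norm_power)
      also have "\<dots> \<le> (K ^ l * L ^ n) * (norm w1 ^ l * norm c ^ n /
          (norm (Gamma (p + of_nat l)) * norm (Gamma (q + \<upsilon> * of_nat n))))"
        by (rule mult_right_mono[OF C]) simp
      also have "\<dots> = \<alpha> l * \<beta> n"
        by (simp add: \<alpha>_def \<beta>_def power_mult_distrib)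
      finally show ?thesis .
    qed
    show "summable (\<lambda>l. \<alpha> l * m l)"
      using summable_power_over_Gamma[of p 1 "K * norm w1 * (z - a)"] pos KL za
      by (simp add: \<alpha>_def m_def power_mult_distrib)
    show "summable (\<lambda>n. \<beta> n * k n)"
      using summable_power_over_Gamma[of q \<upsilon> "L * norm c * (t - b) powr Re \<upsilon>"] pos KL
      by (simp add: \<beta>_def k_def power_mult_distrib)
  qed (use KL za in \<open>auto simp: \<Phi>_def \<Psi>_def m_def k_def \<alpha>_def \<beta>_def\<close>)
  have int: "integrable lborel (\<phi> l)" "integrable lborel (\<psi> l)" for l
    using \<phi>_int \<psi>_int by (auto simp: has_bochner_integral_iff)
  define F where "F = (\<lambda>x y. \<Sum>l. \<Sum>n. A l n * \<phi> l x * \<psi> n y)"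
  note series = lborel_pair.integral_dominated_double_series[of \<phi> \<psi>, OF int prems, folded F_def]

  \<comment> \<open>The prefactor of the function enters the series and turns each term into a product of two Beta integrands.\<close>
  have integrand: "indicator ({a<..<z} \<times> {b<..<t}) (x, y) *\<^sub>R RL_integrand \<sigma> \<tau> d z t x y = F x y" for x y
  proof (cases "a < x \<and> x < z \<and> b < y \<and> y < t")
    case True
    define w where "w = complex_of_real (z - x) powr (\<sigma> - 1) * complex_of_real (t - y) powr (\<tau> - 1) *
      (complex_of_real (x - a) powr (p - 1) * complex_of_real (y - b) powr (q - 1))"
    define f where "f = (\<lambda>l n. ?C l n * (w1 * complex_of_real (x - a)) ^ l *
      (c ^ n * complex_of_real (y - b) powr (\<upsilon> * of_nat n)) / (Gamma (p + of_nat l) * Gamma (q + \<upsilon> * of_nat n)))"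
    have "w \<noteq> 0" using True by (simp add: w_def del: of_real_diff)
    have "w * f l n = A l n * \<phi> l x * \<psi> n y" for l n
    proof -
      have "\<phi> l x = complex_of_real (z - x) powr (\<sigma> - 1) * complex_of_real (x - a) powr (p - 1) * complex_of_real (x - a) ^ l"
        using True beta_kernel_shift_exponent[of a z \<sigma> p 1 l x] of_real_powr_times_of_nat[of "x - a" 1 l]
        by (simp add: \<phi>_def beta_kernel_def)
      moreover have "\<psi> n y = complex_of_real (t - y) powr (\<tau> - 1) * complex_of_real (y - b) powr (q - 1) *
         complex_of_real (y - b) powr (\<upsilon> * of_nat n)"
        using True beta_kernel_shift_exponent[of b t \<tau> q \<upsilon> n y] by (simp add: \<psi>_def beta_kernel_def)
      ultimately show ?thesis
        by (simp add: w_def f_def A_def power_mult_distrib del: of_real_diff)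
    qed
    hence "w * (\<Sum>l. \<Sum>n. f l n) = F x y"
      using double_suminf_cmult_of_summable[OF \<open>w \<noteq> 0\<close>, of f] series(1,2) by (simp add: F_def)
    moreover have "(\<Sum>l. \<Sum>n. f l n) = konhauser_ML \<gamma>1 \<gamma>2 \<gamma>3 \<gamma>4 \<gamma>5 \<gamma>6 p q \<upsilon> (w1 * complex_of_real (x - a)) c (y - b)"
      unfolding konhauser_ML_def f_def konhauser_coeff_def by (simp add: mult_ac del: of_real_diff)
    ultimately show ?thesis
      using True by (simp add: RL_integrand_def d_def w_def mult_ac del: of_real_diff)
  next
    case False
    hence "\<phi> l x = 0 \<or> \<psi> n y = 0" for l n by (auto simp: \<phi>_def \<psi>_def beta_kernel_def)
    hence "A l n * \<phi> l x * \<psi> n y = 0" for l n by (metis mult_zero_left mult_zero_right)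
    hence "F x y = 0" unfolding F_def by (simp only: suminf_zero)
    thus ?thesis using False by (auto simp: indicator_def)
  qed

  have "RL_integrable a b \<sigma> \<tau> d z t"
  proof -
    have "(\<lambda>r. indicator ({a<..<z} \<times> {b<..<t}) r *\<^sub>R (case r of (x, y) \<Rightarrow> RL_integrand \<sigma> \<tau> d z t x y)) = (\<lambda>(x, y). F x y)"
      using integrand by auto
    thus ?thesis unfolding RL_integrable_def set_integrable_def
      using series(3) by (simp only: lborel_prod)
  qed
  moreover have "RL_integral a b \<sigma> \<tau> d z t =
           complex_of_real (z - a) powr (p + \<sigma> - 1) * complex_of_real (t - b) powr (q + \<tau> - 1)
             * konhauser_ML \<gamma>1 \<gamma>2 \<gamma>3 \<gamma>4 \<gamma>5 \<gamma>6 (p + \<sigma>) (q + \<tau>) \<upsilon>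
                 (w1 * complex_of_real (z - a)) c (t - b)"
  proof -
    \<comment> \<open>Termwise, the values \<open>Gamma (p + l)\<close> and \<open>Gamma (q + \<upsilon> * n)\<close> cancel against the Beta integrals and those of \<open>p + \<sigma>\<close> and \<open>q + \<tau>\<close> replace them.\<close>
    define w where "w = Gamma \<tau> * Gamma \<sigma> * (complex_of_real (z - a) powr (p + \<sigma> - 1) * complex_of_real (t - b) powr (q + \<tau> - 1))"
    define f where "f = (\<lambda>l n. ?C l n * (w1 * complex_of_real (z - a)) ^ l *
      (c ^ n * complex_of_real (t - b) powr (\<upsilon> * of_nat n)) / (Gamma (p + \<sigma> + of_nat l) * Gamma (q + \<tau> + \<upsilon> * of_nat n)))"
    have Gnz: "Gamma \<tau> \<noteq> 0" "Gamma \<sigma> \<noteq> 0" using pos by (simp_all add: Gamma_nonzero_if_Re_pos)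
    have "w \<noteq> 0" using za tb Gnz by (simp add: w_def del: of_real_diff)
    have "w * f l n = A l n * integral\<^sup>L lborel (\<phi> l) * integral\<^sup>L lborel (\<psi> n)" for l n
    proof -
      have "\<sigma> + (p + of_nat l) - 1 = (p + \<sigma> - 1) + 1 * of_nat l"
        "\<tau> + (q + \<upsilon> * of_nat n) - 1 = (q + \<tau> - 1) + \<upsilon> * of_nat n" by simp_all
      moreover have "complex_of_real (z - a) powr (1 * of_nat l) = complex_of_real (z - a) ^ l"
        using of_real_powr_times_of_nat[of "z - a" 1 l] za by simp
      ultimately have
        "complex_of_real (z - a) powr (\<sigma> + (p + of_nat l) - 1) = complex_of_real (z - a) powr (p + \<sigma> - 1) * complex_of_real (z - a) ^ l"
        "complex_of_real (t - b) powr (\<tau> + (q + \<upsilon> * of_nat n) - 1) = complex_of_real (t - b) powr (q + \<tau> - 1) * complex_of_real (t - b) powr (\<upsilon> * of_nat n)"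
        by (simp_all only: powr_add)
      moreover have "\<sigma> + (p + of_nat l) = p + \<sigma> + of_nat l" "\<tau> + (q + \<upsilon> * of_nat n) = q + \<tau> + \<upsilon> * of_nat n"
        by simp_all
      ultimately have
        I: "integral\<^sup>L lborel (\<phi> l) = complex_of_real (z - a) powr (p + \<sigma> - 1) * complex_of_real (z - a) ^ l *
            (Gamma \<sigma> * Gamma (p + of_nat l) / Gamma (p + \<sigma> + of_nat l))"
        and J: "integral\<^sup>L lborel (\<psi> n) = complex_of_real (t - b) powr (q + \<tau> - 1) * complex_of_real (t - b) powr (\<upsilon> * of_nat n) *
            (Gamma \<tau> * Gamma (q + \<upsilon> * of_nat n) / Gamma (q + \<tau> + \<upsilon> * of_nat n))"
        using \<phi>_int[of l] \<psi>_int[of n] by (simp_all only: has_bochner_integral_iff)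
      show ?thesis
        unfolding I J using Gamma_nonzero_if_Re_pos[OF p_pos[of l]] Gamma_nonzero_if_Re_pos[OF q_pos[of n]]
        by (simp add: w_def f_def A_def power_mult_distrib del: of_real_diff)
    qed
    hence "w * (\<Sum>l. \<Sum>n. f l n) = (\<integral>y. (\<integral>x. F x y \<partial>lborel) \<partial>lborel)"
      using double_suminf_cmult_of_summable[OF \<open>w \<noteq> 0\<close>, of f] series(4) series(5)
      by (simp add: F_def sums_iff)
    moreover have "(\<Sum>l. \<Sum>n. f l n) = konhauser_ML \<gamma>1 \<gamma>2 \<gamma>3 \<gamma>4 \<gamma>5 \<gamma>6 (p + \<sigma>) (q + \<tau>) \<upsilon>
                 (w1 * complex_of_real (z - a)) c (t - b)"
      unfolding konhauser_ML_def f_def konhauser_coeff_def by (simp add: mult_ac del: of_real_diff)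
    moreover have "(LINT y:{b<..<t}|lborel. (LINT x:{a<..<z}|lborel. RL_integrand \<sigma> \<tau> d z t x y)) =
        (\<integral>y. (\<integral>x. F x y \<partial>lborel) \<partial>lborel)"
    proof -
      have "F x y = indicator {b<..<t} y *\<^sub>R (indicator {a<..<z} x *\<^sub>R RL_integrand \<sigma> \<tau> d z t x y)" for x y
        unfolding integrand[symmetric] by (simp add: indicator_times mult.commute)
      thus ?thesis by (simp only: set_lebesgue_integral_def integral_scaleR_right)
    qed
    ultimately show ?thesis using Gnz
      by (simp add: RL_integral_def w_def field_simps del: of_real_diff)
  qed
  ultimately show ?thesis by blast
qed

end
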